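(* For every integer $n\ge0$, $$c\phi_{12}(2n+1)\equiv0\pmod{16},\qquad c\phi_{12}(3n+1)\equiv0\pmod9,\qquad c\phi_{12}(3n+2)\equiv0\pmod9.$$
   Context: A $k$-colored generalized Frobenius symbol is a two-row array with $d\ge 0$ columns whose entries are colored nonnegative integers $\ell_c$ ($\ell\ge 0$, color $c\in\{1,\dots,k\}$), each row strictly decreasing with respect to the total order $0_1\prec 0_2\prec\cdots\prec 0_k\prec 1_1\prec\cdots\prec 1_k\prec 2_1\prec\cdots$. It is a $k$-colored generalized Frobenius partition of $n=d+\sum(\text{integer values of all entries})$, and $c\phi_k(n)$ is the number of such partitions of $n$. *)

theory Defs
  imports "HOL-Number_Theory.Cong"
begin

text \<open>The colored integer with value \<open>l\<close> and color \<open>c\<close> is the pair \<open>(l, c)\<close>.\<close>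

definition colored_less :: "nat \<times> nat \<Rightarrow> nat \<times> nat \<Rightarrow> bool" where
  "colored_less x y \<longleftrightarrow> fst x < fst y \<or> (fst x = fst y \<and> snd x < snd y)"

definition frobenius_row :: "nat \<Rightarrow> (nat \<times> nat) list \<Rightarrow> bool" where
  "frobenius_row k xs \<longleftrightarrow>
     (\<forall>x\<in>set xs. snd x \<in> {1..k}) \<and> sorted_wrt (\<lambda>x y. colored_less y x) xs"

definition frobenius_symbols :: "nat \<Rightarrow> ((nat \<times> nat) list \<times> (nat \<times> nat) list) set" where
  "frobenius_symbols k =
     {(xs, ys). frobenius_row k xs \<and> frobenius_row k ys \<and> length xs = length ys}"

fun frobenius_size :: "(nat \<times> nat) list \<times> (nat \<times> nat) list \<Rightarrow> nat" where
  "frobenius_size (xs, ys) = length xs + sum_list (map fst xs) + sum_list (map fst ys)"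

definition cphi :: "nat \<Rightarrow> nat \<Rightarrow> nat" where
  "cphi k n = card {s \<in> frobenius_symbols k. frobenius_size s = n}"

text \<open>The set counted by \<open>cphi\<close> is finite, so \<open>card\<close> is a genuine count.\<close>

lemma finite_frobenius_partitions:
  "finite {s \<in> frobenius_symbols k. frobenius_size s = n}"
proof -
  let ?R = "{xs. set xs \<subseteq> {0..n} \<times> {1..k} \<and> length xs \<le> n}"
  have "{s \<in> frobenius_symbols k. frobenius_size s = n} \<subseteq> ?R \<times> ?R"
  proof
    fix s assume s: "s \<in> {s \<in> frobenius_symbols k. frobenius_size s = n}"
    obtain xs ys where xy: "s = (xs, ys)" by (cases s)
    have sz: "length xs + sum_list (map fst xs) + sum_list (map fst ys) = n"
      and rows: "frobenius_row k xs" "frobenius_row k ys" and len: "length xs = length ys"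
      using s xy by (auto simp: frobenius_symbols_def)
    have "fst x \<le> n" if "x \<in> set xs" for x
      using member_le_sum_list[of "fst x" "map fst xs"] that sz by fastforce
    moreover have "fst y \<le> n" if "y \<in> set ys" for y
      using member_le_sum_list[of "fst y" "map fst ys"] that sz by fastforce
    ultimately show "s \<in> ?R \<times> ?R"
      using xy rows len sz by (fastforce simp: frobenius_row_def)
  qed
  moreover have "finite ?R"
    by (rule finite_lists_length_le) simp
  ultimately show ?thesis
    by (meson finite_SigmaI finite_subset)
qed

end

theory Submission
  imports Defs "HOL-Library.Product_Lexorder" "HOL-Library.FuncSet"
begin

text \<open>
  Let \<open>s\<^sub>l\<close> and \<open>t\<^sub>l\<close> be the numbers of entries of value \<open>l\<close> in the top and bottom row. The symbols
  with given \<open>s\<close> and \<open>t\<close> number \<open>\<Prod>\<^sub>l (k choose s\<^sub>l) (k choose t\<^sub>l)\<close>, because the colors at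
  each level can be chosen independently. If \<open>p\<close> does not divide the size
  \<open>n = \<Sum>\<^sub>l s\<^sub>l (l + 1) + \<Sum>\<^sub>l t\<^sub>l l\<close>, then some \<open>s\<^sub>l\<close> or \<open>t\<^sub>l\<close> is not divisible by \<open>p\<close>, and by
  \<open>\<Sum>\<^sub>l s\<^sub>l = \<Sum>\<^sub>l t\<^sub>l\<close> there are at least two such numbers. So if \<open>m\<close> divides \<open>k choose s\<close> whenever
  \<open>p\<close> does not divide \<open>s\<close>, every product is divisible by \<open>m\<^sup>2\<close>. For \<open>k = 12\<close> this applies to
  \<open>(p, m) = (2, 4)\<close> and \<open>(p, m) = (3, 3)\<close>.
\<close>

lemma colored_less_eq_less: "colored_less x y \<longleftrightarrow> x < y"
  by (auto simp: colored_less_def less_prod_def')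

lemma frobenius_row_iff:
  "frobenius_row k xs \<longleftrightarrow> set xs \<subseteq> UNIV \<times> {1..k} \<and> sorted_wrt (<) (rev xs)"
  by (force simp: frobenius_row_def colored_less_eq_less sorted_wrt_rev)

lemma frobenius_row_distinct: "frobenius_row k xs \<Longrightarrow> distinct xs"
  by (metis distinct_rev frobenius_row_iff strict_sorted_iff)

text \<open>Sorting recovers a strictly decreasing list from its set, so counting rows reduces to
  counting finite sets of colored integers.\<close>

lemma bij_betw_set_frobenius_row:
  "bij_betw set {xs. frobenius_row k xs} {A. finite A \<and> A \<subseteq> UNIV \<times> {1..k}}"
  unfolding bij_betw_def
proof
  show "inj_on set {xs. frobenius_row k xs}"
    by (rule inj_onI) (metis frobenius_row_iff mem_Collect_eq rev_rev_ident set_rev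
        strict_sorted_equal)
  show "set ` {xs. frobenius_row k xs} = {A. finite A \<and> A \<subseteq> UNIV \<times> {1..k}}"
  proof (intro equalityI subsetI)
    fix A assume A: "A \<in> {A. finite A \<and> A \<subseteq> (UNIV :: nat set) \<times> {1..k}}"
    show "A \<in> set ` {xs. frobenius_row k xs}"
      by (rule image_eqI[of _ _ "rev (sorted_list_of_set A)"])
        (use A in \<open>auto simp: frobenius_row_iff\<close>)
  qed (auto simp: frobenius_row_iff)
qed

text \<open>As the entries of a row are distinct, counting colors at value \<open>l\<close> counts
  the entries of value \<open>l\<close>.\<close>

definition level_count :: "(nat \<times> nat) list \<Rightarrow> nat \<Rightarrow> nat" where
  "level_count xs l = card (set xs `` {l})"

lemma level_count_eq_0_iff: "level_count xs l = 0 \<longleftrightarrow> l \<notin> fst ` set xs"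
proof -
  have "finite (set xs `` {l})" by simp
  then show ?thesis by (force simp: level_count_def card_eq_0_iff)
qed

text \<open>With \<open>g\<close> constantly 1 this yields the length, with \<open>g\<close> the
  identity the sum of the values, so both depend only on the level counts. A free \<open>L\<close>
  lets two rows share one index set.\<close>

lemma sum_list_frobenius_row:
  fixes g :: "nat \<Rightarrow> nat"
  assumes "frobenius_row k xs" "finite L" "fst ` set xs \<subseteq> L"
  shows "(\<Sum>x\<leftarrow>xs. g (fst x)) = (\<Sum>l\<in>L. g l * level_count xs l)"
proof -
  have "(\<Sum>x\<leftarrow>xs. g (fst x)) = (\<Sum>x\<in>set xs. g (fst x))"
    using frobenius_row_distinct[OF assms(1)] by (simp add: sum_list_distinct_conv_sum_set)
  also have "set xs = Sigma L (\<lambda>l. set xs `` {l})"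
    using assms(3) by force
  also have "(\<Sum>x\<in>\<dots>. g (fst x)) = (\<Sum>l\<in>L. \<Sum>c\<in>set xs `` {l}. g l)"
    using assms(2) by (subst sum.Sigma) (auto simp: case_prod_beta)
  finally show ?thesis
    by (simp add: level_count_def mult.commute)
qed

text \<open>Such a row amounts to an independent choice of \<open>s l\<close> colors at each level
  in \<open>L\<close>; levels outside \<open>L\<close> stay empty.\<close>

lemma card_frobenius_rows_level_count:
  assumes "finite L" "\<And>l. l \<notin> L \<Longrightarrow> s l = 0"
  shows "card {xs. frobenius_row k xs \<and> level_count xs = s} = (\<Prod>l\<in>L. k choose s l)"
proof -
  let ?A = "{A. finite A \<and> A \<subseteq> (UNIV :: nat set) \<times> {1..k} \<and> (\<lambda>l. card (A `` {l})) = s}"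
  let ?P = "PiE L (\<lambda>l. {C. C \<subseteq> {1..k} \<and> card C = s l})"
  have "bij_betw set {xs. frobenius_row k xs \<and> level_count xs = s} ?A"
  proof (rule bij_betw_subset[OF bij_betw_set_frobenius_row[of k]])
    have "set ` {xs. frobenius_row k xs \<and> level_count xs = s} =
        {A \<in> set ` {xs. frobenius_row k xs}. (\<lambda>l. card (A `` {l})) = s}"
      by (auto simp: level_count_def[abs_def])
    then show "set ` {xs. frobenius_row k xs \<and> level_count xs = s} = ?A"
      using bij_betw_set_frobenius_row[of k] by (auto simp: bij_betw_def)
  qed auto
  moreover have "bij_betw (\<lambda>A. \<lambda>l\<in>L. A `` {l}) ?A ?P"
  proof (rule bij_betwI[where g = "\<lambda>C. Sigma L C"])
    show "(\<lambda>A. \<lambda>l\<in>L. A `` {l}) \<in> ?A \<rightarrow> ?P" by auto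
    show "Sigma L \<in> ?P \<rightarrow> ?A"
    proof
      fix C assume C: "C \<in> ?P"
      have sub: "C l \<subseteq> {1..k}" "card (C l) = s l" if "l \<in> L" for l
        using PiE_mem[OF C that] by auto
      have "Sigma L C `` {l} = (if l \<in> L then C l else {})" for l by auto
      then have "card (Sigma L C `` {l}) = s l" for l
        using sub assms(2) by simp
      moreover have "finite (Sigma L C)"
        using assms(1) sub by (meson finite_SigmaI finite_atLeastAtMost finite_subset)
      ultimately show "Sigma L C \<in> ?A" using sub by auto
    qed
    show "Sigma L (\<lambda>l\<in>L. A `` {l}) = A" if "A \<in> ?A" for A
    proof -
      from that have A: "finite A" "\<And>l. card (A `` {l}) = s l" by auto
      \<comment> \<open>Off \<open>L\<close> the counts are 0, and a finite set has
        \<open>card\<close> 0 only if it is empty.\<close>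
      have "l \<in> L" if "(l, c) \<in> A" for l c
      proof -
        have "finite (A `` {l})" "c \<in> A `` {l}"
          using A(1) that by auto
        then have "s l \<noteq> 0"
          unfolding A(2)[symmetric] by (metis card_0_eq empty_iff)
        then show ?thesis using assms(2) by metis
      qed
      then show ?thesis by auto
    qed
    show "(\<lambda>l\<in>L. Sigma L C `` {l}) = C" if "C \<in> ?P" for C
    proof
      show "(\<lambda>l\<in>L. Sigma L C `` {l}) l = C l" for l
        using PiE_arb[OF that, of l] by (cases "l \<in> L") auto
    qed
  qed
  ultimately have "card {xs. frobenius_row k xs \<and> level_count xs = s} = card ?P"
    by (rule bij_betw_same_card[OF bij_betw_trans])
  also have "\<dots> = (\<Prod>l\<in>L. k choose s l)"
    using assms(1) n_subsets[of "{1..k}"] by (simp add: card_PiE)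
  finally show ?thesis .
qed

lemma dvd_prod_choose:
  fixes s :: "'a \<Rightarrow> nat"
  assumes "finite L" "\<And>j. \<not> p dvd j \<Longrightarrow> m dvd k choose j" "l \<in> L" "\<not> p dvd s l"
  shows "m dvd (\<Prod>l\<in>L. k choose s l)"
  using assms by (meson dvd_prodI dvd_trans)

text \<open>A sum divisible by \<open>p\<close> cannot have exactly one term not divisible by
  \<open>p\<close>, so two different factors each supply an \<open>m\<close>.\<close>

lemma square_dvd_prod_choose:
  fixes s :: "'a \<Rightarrow> nat"
  assumes "finite L" "\<And>j. \<not> p dvd j \<Longrightarrow> m dvd k choose j" "l \<in> L" "\<not> p dvd s l"
    and "p dvd (\<Sum>l\<in>L. s l)"
  shows "m * m dvd (\<Prod>l\<in>L. k choose s l)"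
proof -
  have "\<not> p dvd (\<Sum>l\<in>L - {l}. s l)"
    using assms by (metis dvd_add_left_iff sum.remove)
  then obtain l' where "l' \<in> L - {l}" "\<not> p dvd s l'"
    by (meson dvd_sum)
  then have "m dvd (\<Prod>l\<in>L - {l}. k choose s l)"
    using dvd_prod_choose assms by (metis finite_Diff)
  then show ?thesis
    using assms by (simp add: prod.remove mult_dvd_mono)
qed

lemma square_dvd_cphi:
  assumes choose: "\<And>j. \<not> p dvd j \<Longrightarrow> m dvd k choose j" and "\<not> p dvd n"
  shows "m * m dvd cphi k n"
proof -
  define X where "X = {s \<in> frobenius_symbols k. frobenius_size s = n}"
  define R where "R s = {xs. frobenius_row k xs \<and> level_count xs = s}" for s
  let ?P = "map_prod level_count level_count"
  have fibre: "m * m dvd card {z \<in> X. ?P z = ?P x}" if "x \<in> X" for x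
  proof -
    obtain xs ys where x: "x = (xs, ys)" by (cases x)
    define L where "L = fst ` set xs \<union> fst ` set ys"
    have L: "finite L" by (simp add: L_def)
    have row: "frobenius_row k xs" "frobenius_row k ys"
      and len: "length xs = length ys" and size: "frobenius_size (xs, ys) = n"
      using that by (auto simp: X_def x frobenius_symbols_def)
    have supp: "fst ` set us \<subseteq> L"
      if "level_count us = level_count xs \<or> level_count us = level_count ys" for us
      using that by (metis L_def UnCI level_count_eq_0_iff subsetI)
    have length: "length us = (\<Sum>l\<in>L. level_count us l)"
      and total: "sum_list (map fst us) = (\<Sum>l\<in>L. l * level_count us l)"
      if "frobenius_row k us" "level_count us = level_count xs \<or> level_count us = level_count ys"
      for us
      using sum_list_frobenius_row[OF that(1) L supp[OF that(2)], of "\<lambda>_. 1"]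
        sum_list_frobenius_row[OF that(1) L supp[OF that(2)], of "\<lambda>l. l"]
      by (simp_all add: sum_list_triv)
    have cardR: "card (R (level_count us)) = (\<Prod>l\<in>L. k choose level_count us l)"
      if "fst ` set us \<subseteq> L" for us
      unfolding R_def using that
      by (intro card_frobenius_rows_level_count[OF L]) (auto simp: level_count_eq_0_iff)
    \<comment> \<open>Length and size depend only on the level counts, so the two rows of a symbol
      in the fibre vary independently.\<close>
    have "{z \<in> X. ?P z = ?P x} = R (level_count xs) \<times> R (level_count ys)"
      using row len size by (auto simp: X_def R_def x frobenius_symbols_def length total)
    then have card: "card {z \<in> X. ?P z = ?P x} =
        (\<Prod>l\<in>L. k choose level_count xs l) * (\<Prod>l\<in>L. k choose level_count ys l)"
      using cardR[of xs] cardR[of ys] by (simp add: card_cartesian_product L_def)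
    show ?thesis
    \<comment> \<open>If \<open>p\<close> divides the number of columns, two nonmultiples of
      \<open>p\<close> are found in one row; otherwise each row contains one.\<close>
    proof (cases "p dvd length xs")
      case True
      then have sums: "p dvd (\<Sum>l\<in>L. level_count xs l)" "p dvd (\<Sum>l\<in>L. level_count ys l)"
        using length row len by metis+
      have "\<exists>l\<in>L. \<not> p dvd level_count xs l \<or> \<not> p dvd level_count ys l"
      proof (rule ccontr)
        assume "\<not> ?thesis"
        \<comment> \<open>All three summands of the size would then be multiples of
          \<open>p\<close>.\<close>
        then have "p dvd sum_list (map fst xs)" "p dvd sum_list (map fst ys)"
          using total row by (auto intro!: dvd_sum)
        then show False using True size \<open>\<not> p dvd n\<close> by auto
      qed
      then obtain l where "l \<in> L" "\<not> p dvd level_count xs l \<or> \<not> p dvd level_count ys l"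
        by blast
      then have "m * m dvd (\<Prod>l\<in>L. k choose level_count xs l) \<or>
          m * m dvd (\<Prod>l\<in>L. k choose level_count ys l)"
        using square_dvd_prod_choose[OF L choose] sums by blast
      then show ?thesis
        unfolding card by (auto intro: dvd_mult dvd_mult2)
    next
      case False
      then have "\<not> p dvd (\<Sum>l\<in>L. level_count xs l)" "\<not> p dvd (\<Sum>l\<in>L. level_count ys l)"
        using length row len by metis+
      then obtain l l' where "l \<in> L" "\<not> p dvd level_count xs l" "l' \<in> L" "\<not> p dvd level_count ys l'"
        using dvd_sum by metis
      then show ?thesis
        unfolding card by (intro mult_dvd_mono dvd_prod_choose[OF L choose])
    qed
  qed
  have "finite X"
    unfolding X_def by (rule finite_frobenius_partitions)
  then have "card X = (\<Sum>v\<in>?P ` X. card {z \<in> X. ?P z = v})"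
    using sum.image_gen[of X "\<lambda>_. 1 :: nat" ?P] by simp
  also have "m * m dvd \<dots>"
    using fibre by (auto intro!: dvd_sum)
  finally show ?thesis
    by (simp add: cphi_def X_def)
qed

text \<open>The reason is \<open>j * (12 choose j) = 12 * (11 choose (j - 1))\<close> for
  \<open>j > 0\<close>, with 4 or 3 coprime to \<open>j\<close>. The proof evaluates the cases
  \<open>j \<le> 12\<close>; beyond them the coefficient is 0.\<close>

lemma dvd_12_choose:
  fixes j :: nat
  shows four_dvd_12_choose: "\<not> 2 dvd j \<Longrightarrow> 4 dvd 12 choose j"
    and three_dvd_12_choose: "\<not> 3 dvd j \<Longrightarrow> 3 dvd 12 choose j"
proof -
  have "(\<not> 2 dvd j \<longrightarrow> 4 dvd 12 choose j) \<and> (\<not> 3 dvd j \<longrightarrow> 3 dvd 12 choose j)"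
  proof (cases "j \<le> 12")
    case True
    then have "j \<in> {0, 1, 2, 3, 4, 5, 6, 7, 8, 9, 10, 11, 12}"
      by (simp, presburger)
    then show ?thesis by (auto simp: binomial_fact' fact_numeral)
  qed (simp add: binomial_eq_0)
  then show "\<not> 2 dvd j \<Longrightarrow> 4 dvd 12 choose j" "\<not> 3 dvd j \<Longrightarrow> 3 dvd 12 choose j"
    by blast+
qed

theorem theorem6p8:
  fixes n :: nat
  shows "[cphi 12 (2 * n + 1) = 0] (mod 16) \<and>
         [cphi 12 (3 * n + 1) = 0] (mod 9) \<and>
         [cphi 12 (3 * n + 2) = 0] (mod 9)"
proof -
  have "\<not> 2 dvd 2 * n + 1" "\<not> 3 dvd 3 * n + 1" "\<not> 3 dvd 3 * n + 2"
    by presburger+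
  then show ?thesis
    using square_dvd_cphi[OF four_dvd_12_choose] square_dvd_cphi[OF three_dvd_12_choose]
    by (simp add: cong_0_iff)
qed

end
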